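(* Let $F:\mathbb{R}^N\to\mathbb{R}\cup\{+\infty\}$ be a proper, closed, convex function with $\operatorname{dom}(F)\subset\Lambda$. Suppose $\mu$ is absolutely continuous with respect to Lebesgue measure and $c$ satisfies the twist condition. Then minimizers of the primal problem are unique: there is at most one pair $(\gamma,\lambda)$ with $\lambda\in\Lambda$, $\gamma\in\Pi(\mu,\nu_\lambda)$ such that $$\int_{X\times Y} c\,d\gamma+F(\lambda)=\min_{\tilde\lambda\in\Lambda,\ \tilde\gamma\in\Pi(\mu,\nu_{\tilde\lambda})}\left(\int_{X\times Y} c\,d\tilde\gamma+F(\tilde\lambda)\right).$$
   Context: Fix positive integers $N,n$, a set $Y=\{y_j\}_{j=1}^N\subset\mathbb{R}^n$ of $N$ points, a compact set $X\subset\mathbb{R}^n$, and a Borel probability measure $\mu$ on $X$ with $\operatorname{spt}\mu=X$. The cost $c:X\times Y\to\mathbb{R}_{\ge0}$ is continuous and $c(\cdot,y_j)\in C^1(X)$ for each $1\le j\le N$. Write $\Lambda=\{\lambda\in\mathbb{R}^N: \sum_{j=1}^N\lambda^j=1,\ \lambda^j\ge 0\}$ and, for $\lambda\in\Lambda$, $\nu_\lambda=\sum_{j=1}^N\lambda^j\delta_{y_j}$. $\Pi(\mu,\nu)$ is the set of probability measures on $X\times Y$ with left and right marginals $\mu$ and $\nu$. For convex $F$, $\operatorname{dom}(F)=\{x: F(x)<\infty\}$; proper means not identically $+\infty$; closed means lower semicontinuous. Twist condition: for each $x_0\in X$ and all $j\ne k$, $-\nabla_x c(x_0,y_j)\ne-\nabla_x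 c(x_0,y_k)$. *)

theory Defs
  imports "HOL-Probability.Probability"
begin

section \<open>Extended-real-valued convex functions\<close>

definition proper_fun :: "('a \<Rightarrow> ereal) \<Rightarrow> bool" where
  "proper_fun F \<longleftrightarrow> (\<exists>x. F x \<noteq> \<infinity>)"

definition closed_fun :: "('a::topological_space \<Rightarrow> ereal) \<Rightarrow> bool" where
  "closed_fun F \<longleftrightarrow> (\<forall>x. F x \<le> Liminf (at x) F)"

text \<open>
  Intended for functions that never take the value \<open>-\<infinity>\<close>; the library's \<open>convex_on\<close> is
  restricted to finite values. The endpoint cases are harmless since \<open>0 * \<infinity> = 0\<close> in
  \<open>ereal\<close>.
\<close>
definition convex_fun :: "('a::real_vector \<Rightarrow> ereal) \<Rightarrow> bool" where
  "convex_fun F \<longleftrightarrow> (\<forall>x y. \<forall>u\<ge>0. \<forall>v\<ge>0. u + v = 1 \<longrightarrow>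
     F (u *\<^sub>R x + v *\<^sub>R y) \<le> ereal u * F x + ereal v * F y)"

definition dom_fun :: "('a \<Rightarrow> ereal) \<Rightarrow> 'a set" where
  "dom_fun F = {x. F x < \<infinity>}"

section \<open>Continuous differentiability on a set\<close>

text \<open>
  \<open>f\<close> is continuously differentiable on \<open>X\<close> with gradient field \<open>g\<close>, with derivatives
  taken within \<open>X\<close>; only the values of \<open>f\<close> on \<open>X\<close> matter. If \<open>f\<close> is the restriction of a
  \<open>C\<^sup>1\<close> function on an open neighbourhood of \<open>X\<close>, the restricted gradient of that
  function is such a \<open>g\<close>. The field \<open>g\<close> is an argument because derivatives within \<open>X\<close>
  need not be unique at every boundary point.
\<close>
definition C1_on_with_gradient ::
  "'a::real_inner set \<Rightarrow> ('a \<Rightarrow> real) \<Rightarrow> ('a \<Rightarrow> 'a) \<Rightarrow> bool" where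
  "C1_on_with_gradient X f g \<longleftrightarrow> continuous_on X g \<and>
     (\<forall>x\<in>X. (f has_derivative (\<lambda>h. g x \<bullet> h)) (at x within X))"

text \<open>The index \<open>j\<close> of \<open>G\<close> stands for the target point \<open>y\<^sub>j\<close>.\<close>
definition twist :: "'a::real_inner set \<Rightarrow> ('m \<Rightarrow> 'a \<Rightarrow> 'a) \<Rightarrow> bool" where
  "twist X G \<longleftrightarrow> (\<forall>x0\<in>X. \<forall>j k. j \<noteq> k \<longrightarrow> - G j x0 \<noteq> - G k x0)"

section \<open>Measures and transport plans\<close>

text \<open>
  Probability measures on a Borel subset of Euclidean space are represented as Borel measures
  on the whole space that give the subset full mass.
\<close>
definition borel_prob_on :: "'a::topological_space set \<Rightarrow> 'a measure \<Rightarrow> bool" where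
  "borel_prob_on A M \<longleftrightarrow> sets M = sets borel \<and> prob_space M \<and> emeasure M A = 1"

definition spt :: "'a::topological_space measure \<Rightarrow> 'a set" where
  "spt M = {x. \<forall>U. open U \<longrightarrow> x \<in> U \<longrightarrow> emeasure M U > 0}"

definition prob_simplex :: "(real ^ 'm) set" where
  "prob_simplex = {l. (\<Sum>j\<in>UNIV. l $ j) = 1 \<and> (\<forall>j. l $ j \<ge> 0)}"

definition discrete_measure ::
  "('m::finite \<Rightarrow> 'a::topological_space) \<Rightarrow> real ^ 'm \<Rightarrow> 'a measure" where
  "discrete_measure y l = measure_of UNIV (sets borel)
     (\<lambda>A. \<Sum>j\<in>UNIV. ennreal (l $ j) * emeasure (return borel (y j)) A)"

lemma sets_discrete_measure [simp]: "sets (discrete_measure y l) = sets borel"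
  unfolding discrete_measure_def using sets.sigma_sets_eq[of borel] by simp

lemma emeasure_discrete_measure:
  assumes "A \<in> sets borel"
  shows "emeasure (discrete_measure y l) A
    = (\<Sum>j\<in>UNIV. ennreal (l $ j) * emeasure (return borel (y j)) A)"
proof (rule emeasure_measure_of[OF discrete_measure_def])
  show "countably_additive (sets (discrete_measure y l))
     (\<lambda>A. \<Sum>j\<in>UNIV. ennreal (l $ j) * emeasure (return borel (y j)) A)"
  proof (rule countably_additiveI)
    fix B :: "nat \<Rightarrow> 'a set"
    assume B: "range B \<subseteq> sets (discrete_measure y l)" "disjoint_family B"
    have "(\<Sum>i. \<Sum>j\<in>UNIV. ennreal (l $ j) * emeasure (return borel (y j)) (B i))
      = (\<Sum>j\<in>UNIV. \<Sum>i. ennreal (l $ j) * emeasure (return borel (y j)) (B i))"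
      by (rule suminf_sum) simp
    also have "\<dots> = (\<Sum>j\<in>UNIV. ennreal (l $ j) * emeasure (return borel (y j)) (\<Union>i. B i))"
      using B by (intro sum.cong refl) (subst ennreal_suminf_cmult, subst suminf_emeasure, auto)
    finally show "(\<Sum>i. \<Sum>j\<in>UNIV. ennreal (l $ j) * emeasure (return borel (y j)) (B i))
      = (\<Sum>j\<in>UNIV. ennreal (l $ j) * emeasure (return borel (y j)) (\<Union>i. B i))" .
  qed
qed (use assms in \<open>auto simp: positive_def\<close>)

definition transport_plans ::
  "'a::topological_space set \<Rightarrow> 'b::topological_space set \<Rightarrow> 'a measure \<Rightarrow> 'b measure \<Rightarrow> ('a \<times> 'b) measure set" where
  "transport_plans X Y \<mu> \<nu> =
     {\<gamma>. borel_prob_on (X \<times> Y) \<gamma> \<and> distr \<gamma> borel fst = \<mu> \<and> distr \<gamma> borel snd = \<nu>}"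

section \<open>The primal problem\<close>

definition primal_feasible ::
  "'a::topological_space set \<Rightarrow> ('m::finite \<Rightarrow> 'a) \<Rightarrow> 'a measure \<Rightarrow> ('a \<times> 'a) measure \<times> (real ^ 'm) \<Rightarrow> bool" where
  "primal_feasible X y \<mu> = (\<lambda>(\<gamma>, l).
     l \<in> prob_simplex \<and> \<gamma> \<in> transport_plans X (range y) \<mu> (discrete_measure y l))"

text \<open>
  The set integral is the Bochner integral: for a continuous cost and compact \<open>X\<close>, the cost is
  bounded and Borel on \<open>X \<times> range y\<close>, hence integrable.
\<close>
definition primal_cost ::
  "'a::topological_space set \<Rightarrow> ('m::finite \<Rightarrow> 'a) \<Rightarrow> ('a \<Rightarrow> 'a \<Rightarrow> real) \<Rightarrow> (real ^ 'm \<Rightarrow> ereal)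
    \<Rightarrow> ('a \<times> 'a) measure \<times> (real ^ 'm) \<Rightarrow> ereal" where
  "primal_cost X y c F = (\<lambda>(\<gamma>, l).
     ereal (set_lebesgue_integral \<gamma> (X \<times> range y) (\<lambda>(x, z). c x z)) + F l)"

end

theory Submission
  imports Defs
begin

text \<open>
  A plan \<open>\<gamma>\<close> with finitely many targets is the same thing as a family of weights \<open>f j x\<close>, the
  fraction of the mass at \<open>x\<close> that goes to \<open>y j\<close> (\<open>transport_plan_eq_weighted_plan\<close>). In these
  terms the primal problem minimises the linear functional \<open>\<Sum>j. \<integral> f j x * c x (y j) \<partial>\<mu>\<close> plus a
  convex function of the masses \<open>\<integral> f j \<partial>\<mu>\<close>, so the minimizers form a convex set. Uniqueness
  follows once every minimizer is an extreme point of the set of all weights: if the midpoint of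
  two minimizers takes only the values 0 and 1, the two coincide (\<open>minimizing_weights_unique\<close>).

  A minimizer does take only the values 0 and 1 (\<open>optimal_weights_are_indicators\<close>). If a set of
  positive measure were split between \<open>y j\<close> and \<open>y k\<close>, then mass could be exchanged inside that set
  without affecting either marginal, and this lowers the cost unless \<open>c x (y j) - c x (y k)\<close> is
  constant there. Constancy on a set of positive measure is excluded by the twist condition:
  a level set of a function with nowhere vanishing gradient is Lebesgue null
  (\<open>negligible_level_set_of_nonzero_gradient\<close>), hence \<open>\<mu>\<close>-null.
\<close>

section \<open>Level sets of functions with nonvanishing gradient\<close>

text \<open>
  If shifts of \<open>S\<close> by different small multiples of \<open>v\<close> never meet, then infinitely many
  disjoint copies of \<open>S\<close>, all of the same measure, fit into one bounded set.
\<close>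
lemma negligible_if_small_translates_disjoint:
  fixes S :: "'a::euclidean_space set"
  assumes "compact S" "0 < d"
    and disj: "\<And>x t. x \<in> S \<Longrightarrow> 0 < t \<Longrightarrow> t < d \<Longrightarrow> x + t *\<^sub>R v \<notin> S"
  shows "negligible S"
proof -
  define t where "t q = d / (real q + 2)" for q :: nat
  define T where "T q = (+) (t q *\<^sub>R v) ` S" for q
  define K where "K = (\<lambda>p. fst p + snd p *\<^sub>R v) ` (S \<times> {0..d})"
  have t: "0 < t q" "t q < d" for q
    using \<open>0 < d\<close> by (auto simp: t_def field_simps intro!: add_pos_nonneg)
  have t_less: "t q < t p" if "p < q" for p q
    using that \<open>0 < d\<close> unfolding t_def by (intro divide_strict_left_mono) auto
  have S_lmeas: "S \<in> lmeasurable"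
    using \<open>compact S\<close> by (rule lmeasurable_compact)
  have T_lmeas: "T q \<in> lmeasurable" for q
    unfolding T_def using S_lmeas by (rule measurable_translation)
  have T_disj: "T p \<inter> T q = {}" if "p < q" for p q
  proof (rule ccontr)
    assume "T p \<inter> T q \<noteq> {}"
    then obtain x x' where "x \<in> S" "x' \<in> S" "t p *\<^sub>R v + x = t q *\<^sub>R v + x'"
      unfolding T_def by auto
    then have "x + (t p - t q) *\<^sub>R v = x'"
      by (simp add: algebra_simps)
    then show False
      using disj[OF \<open>x \<in> S\<close>, of "t p - t q"] \<open>x' \<in> S\<close> t_less[OF that] t[of p] t[of q] by auto
  qed
  have "compact K"
    unfolding K_def using \<open>compact S\<close>
    by (intro compact_continuous_image continuous_intros compact_Times) auto
  then have K_lmeas: "K \<in> lmeasurable" by (rule lmeasurable_compact)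
  have T_sub: "T q \<subseteq> K" for q
  proof
    fix z assume "z \<in> T q"
    then obtain x where "x \<in> S" "z = x + t q *\<^sub>R v" by (auto simp: T_def add.commute)
    then show "z \<in> K"
      unfolding K_def using t[of q] by (intro image_eqI[of _ _ "(x, t q)"]) auto
  qed
  have bound: "real n * measure lebesgue S \<le> measure lebesgue K" for n
  proof -
    have "real n * measure lebesgue S = (\<Sum>q<n. measure lebesgue (T q))"
      by (simp add: T_def measure_translation)
    also have "\<dots> = measure lebesgue (\<Union>q<n. T q)"
      using T_disj T_lmeas
      by (intro measure_UNION'[symmetric]) (auto simp: pairwise_def disjnt_def neq_iff Int_commute)
    also have "\<dots> \<le> measure lebesgue K"
      using T_sub T_lmeas K_lmeas
      by (intro measure_mono_fmeasurable) (auto intro!: sets.finite_UN simp: fmeasurable_def)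
    finally show ?thesis .
  qed
  have "measure lebesgue S = 0"
  proof (rule ccontr)
    assume "measure lebesgue S \<noteq> 0"
    then have "0 < measure lebesgue S" by (simp add: zero_less_measure_iff)
    from reals_Archimedean3[OF this] bound show False
      by (meson not_less)
  qed
  with S_lmeas show ?thesis
    by (simp add: negligible_iff_measure)
qed

text \<open>
  Near a point \<open>x\<close> of a level set, the first-order expansion keeps the level set inside a cone
  around the hyperplane orthogonal to \<open>w x\<close>. Hence, for a basis vector \<open>i\<close> with
  \<open>w x \<bullet> i \<noteq> 0\<close>, no point \<open>x + t *\<^sub>R i\<close> with small \<open>t > 0\<close> is on the same level. How small
  \<open>t\<close> must be depends on \<open>x\<close>, so the level set is cut into countably many pieces on which
  ``small'' has a fixed meaning; each piece is disjoint from its small translates.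
\<close>
lemma negligible_level_set_of_nonzero_gradient:
  fixes X :: "'a::euclidean_space set"
  assumes "compact X" and C1: "C1_on_with_gradient X g w"
    and nz: "\<And>x. x \<in> X \<Longrightarrow> w x \<noteq> 0"
  shows "negligible {x\<in>X. g x = a}"
proof -
  define E where "E = {x\<in>X. g x = a}"
  \<comment> \<open>The cone condition is required at scale \<open>1 / (p + 1)\<close>. Its slope is half of the slope of \<open>g\<close> in
    direction \<open>i\<close>, so that a second point \<open>x + t *\<^sub>R i\<close> violates it.\<close>
  define S where "S i p = {x\<in>E. \<bar>w x \<bullet> i\<bar> \<ge> 1 / real (Suc p) \<and>
    (\<forall>z\<in>E. norm (z - x) < 1 / real (Suc p) \<longrightarrow> \<bar>w x \<bullet> (z - x)\<bar> \<le> \<bar>w x \<bullet> i\<bar> / 2 * norm (z - x))}"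
    for i p
  have w_cont: "continuous_on X w"
    and deriv: "\<And>x. x \<in> X \<Longrightarrow> (g has_derivative (\<lambda>h. w x \<bullet> h)) (at x within X)"
    using C1 by (auto simp: C1_on_with_gradient_def)
  have g_cont: "continuous_on X g"
    using deriv by (rule has_derivative_continuous_on)
  have "closed E"
    unfolding E_def using g_cont \<open>compact X\<close>
    by (intro continuous_closed_preimage_constant compact_imp_closed) auto
  then have "compact E"
    using \<open>compact X\<close> by (metis (no_types, lifting) E_def compact_Int_closed inf.absorb_iff2
      mem_Collect_eq subsetI)
  \<comment> \<open>The pieces are closed because \<open>w\<close> is continuous and every inequality in their definition
    that has to survive the limit is weak.\<close>
  have S_compact: "compact (S i p)" for i p
  proof -
    have "closed (S i p)"
      unfolding closed_sequential_limits
    proof (intro allI impI, elim conjE)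
      fix u x assume u: "\<forall>n. u n \<in> S i p" and lim: "u \<longlonglongrightarrow> x"
      have uE: "u n \<in> E" and uX: "u n \<in> X" for n using u by (auto simp: S_def E_def)
      have "x \<in> E" using closed_sequentially[OF \<open>closed E\<close>] uE lim by auto
      then have "x \<in> X" by (simp add: E_def)
      have w_lim: "(\<lambda>n. w (u n)) \<longlonglongrightarrow> w x"
        using w_cont uX \<open>x \<in> X\<close> lim by (auto simp: continuous_on_sequentially o_def)
      show "x \<in> S i p"
        unfolding S_def
      proof (safe intro!: \<open>x \<in> E\<close>)
        show "1 / real (Suc p) \<le> \<bar>w x \<bullet> i\<bar>"
          using u by (intro LIMSEQ_le_const[of "\<lambda>n. \<bar>w (u n) \<bullet> i\<bar>"] tendsto_intros w_lim)
            (auto simp: S_def)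
        fix z assume "z \<in> E" and near: "norm (z - x) < 1 / real (Suc p)"
        have "(\<lambda>n. norm (z - u n)) \<longlonglongrightarrow> norm (z - x)"
          by (intro tendsto_intros lim)
        then have ev: "\<forall>\<^sub>F n in sequentially. norm (z - u n) < 1 / real (Suc p)"
          using near by (rule order_tendstoD)
        show "\<bar>w x \<bullet> (z - x)\<bar> \<le> \<bar>w x \<bullet> i\<bar> / 2 * norm (z - x)"
        proof (rule tendsto_le[OF sequentially_bot])
          show "(\<lambda>n. \<bar>w (u n) \<bullet> i\<bar> / 2 * norm (z - u n)) \<longlonglongrightarrow> \<bar>w x \<bullet> i\<bar> / 2 * norm (z - x)"
            by (intro tendsto_intros lim w_lim) simp
          show "(\<lambda>n. \<bar>w (u n) \<bullet> (z - u n)\<bar>) \<longlonglongrightarrow> \<bar>w x \<bullet> (z - x)\<bar>"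
            by (intro tendsto_intros lim w_lim)
          show "\<forall>\<^sub>F n in sequentially. \<bar>w (u n) \<bullet> (z - u n)\<bar> \<le> \<bar>w (u n) \<bullet> i\<bar> / 2 * norm (z - u n)"
            using ev by eventually_elim (use u \<open>z \<in> E\<close> in \<open>auto simp: S_def\<close>)
        qed
      qed
    qed
    moreover have "S i p = E \<inter> S i p" by (auto simp: S_def)
    ultimately show ?thesis using \<open>compact E\<close> by (metis compact_Int_closed)
  qed
  have S_negl: "negligible (S i p)" if "i \<in> Basis" for i p
  proof (rule negligible_if_small_translates_disjoint[OF S_compact])
    show "0 < 1 / real (Suc p)" by simp
    fix x t assume x: "x \<in> S i p" and t: "0 < t" "t < 1 / real (Suc p)"
    show "x + t *\<^sub>R i \<notin> S i p"
    proof
      assume "x + t *\<^sub>R i \<in> S i p"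
      then have "x + t *\<^sub>R i \<in> E" by (simp add: S_def)
      then have "\<bar>w x \<bullet> (t *\<^sub>R i)\<bar> \<le> \<bar>w x \<bullet> i\<bar> / 2 * norm (t *\<^sub>R i)"
        using x t that unfolding S_def by force
      then have "t * \<bar>w x \<bullet> i\<bar> \<le> t * (\<bar>w x \<bullet> i\<bar> / 2)"
        using t that by (simp add: abs_mult mult.commute)
      then have "\<bar>w x \<bullet> i\<bar> \<le> 0" using t by simp
      moreover have "0 < 1 / real (Suc p)" "1 / real (Suc p) \<le> \<bar>w x \<bullet> i\<bar>" using x by (auto simp: S_def)
      ultimately show False by linarith
    qed
  qed
  have "E \<subseteq> (\<Union>i\<in>Basis. \<Union>p. S i p)"
  proof
    fix x assume "x \<in> E"
    then have "x \<in> X" "g x = a" by (auto simp: E_def)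
    obtain i where i: "i \<in> Basis" "w x \<bullet> i \<noteq> 0"
      using nz[OF \<open>x \<in> X\<close>] by (metis euclidean_all_zero_iff)
    obtain r where r: "r > 0" "\<And>z. z \<in> X \<Longrightarrow> norm (z - x) < r \<Longrightarrow>
        norm (g z - g x - w x \<bullet> (z - x)) \<le> \<bar>w x \<bullet> i\<bar> / 2 * norm (z - x)"
      using deriv[OF \<open>x \<in> X\<close>] i unfolding has_derivative_within_alt
      by (metis half_gt_zero zero_less_abs_iff)
    obtain p where p: "1 / real (Suc p) < min r \<bar>w x \<bullet> i\<bar>"
      using reals_Archimedean[of "min r \<bar>w x \<bullet> i\<bar>"] r(1) i(2) by (auto simp: inverse_eq_divide)
    have "x \<in> S i p"
      unfolding S_def
    proof (safe intro!: \<open>x \<in> E\<close>)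
      show "1 / real (Suc p) \<le> \<bar>w x \<bullet> i\<bar>" using p by simp
      fix z assume "z \<in> E" "norm (z - x) < 1 / real (Suc p)"
      then show "\<bar>w x \<bullet> (z - x)\<bar> \<le> \<bar>w x \<bullet> i\<bar> / 2 * norm (z - x)"
        using r(2)[of z] p \<open>g x = a\<close> by (simp add: E_def)
    qed
    then show "x \<in> (\<Union>i\<in>Basis. \<Union>p. S i p)" using i by blast
  qed
  moreover have "negligible (\<Union>i\<in>Basis. \<Union>p. S i p)"
    using S_negl by (intro negligible_Union_nat negligible_Union finite_imageI finite_Basis) (auto intro!: negligible_Union_nat)
  ultimately show ?thesis unfolding E_def by (rule negligible_subset[rotated])
qed

section \<open>Transport plans with finitely many targets\<close>

text \<open>
  \<open>f j x\<close> is the fraction of the mass at \<open>x\<close> that is sent to \<open>y j\<close>. The identities hold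
  everywhere, not only almost everywhere, so that no null sets have to be carried along.
\<close>
definition transport_weights :: "('m::finite \<Rightarrow> 'a::topological_space \<Rightarrow> real) \<Rightarrow> bool" where
  "transport_weights f \<longleftrightarrow>
     (\<forall>j. f j \<in> borel_measurable borel) \<and> (\<forall>j x. 0 \<le> f j x) \<and> (\<forall>x. (\<Sum>j\<in>UNIV. f j x) = 1)"

text \<open>
  The measure \<open>\<Sum>j. (f j \<mu>) \<otimes> \<delta> (y j)\<close>, written as an image of a density on
  \<open>\<mu> \<Otimes>\<^sub>M count_space UNIV\<close> so that integrals against it reduce to Tonelli's theorem.
\<close>
definition weighted_plan ::
  "'a::topological_space measure \<Rightarrow> ('m::finite \<Rightarrow> 'a) \<Rightarrow> ('m \<Rightarrow> 'a \<Rightarrow> real) \<Rightarrow> ('a \<times> 'a) measure" where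
  "weighted_plan \<mu> y f = distr (density (\<mu> \<Otimes>\<^sub>M count_space UNIV) (\<lambda>(x, j). ennreal (f j x)))
     borel (\<lambda>(x, j). (x, y j))"

definition target_weights ::
  "'a measure \<Rightarrow> ('m::finite \<Rightarrow> 'a \<Rightarrow> real) \<Rightarrow> real ^ 'm" where
  "target_weights \<mu> f = (\<chi> j. \<integral>x. f j x \<partial>\<mu>)"

lemma (in finite_measure) integrable_mult_bounded:
  fixes u v :: "'a \<Rightarrow> real"
  assumes [measurable]: "u \<in> borel_measurable M" "v \<in> borel_measurable M"
    and bound: "\<And>x. \<bar>u x\<bar> \<le> a" "\<And>x. \<bar>v x\<bar> \<le> b"
  shows "integrable M (\<lambda>x. u x * v x)"
proof (rule integrable_const_bound[where B="a * b"])
  have "0 \<le> a" using bound(1)[of undefined] by linarith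
  then have "\<bar>u x\<bar> * \<bar>v x\<bar> \<le> a * b" for x
    using bound by (intro mult_mono) auto
  then show "AE x in M. norm (u x * v x) \<le> a * b" by (simp add: abs_mult)
qed measurable

lemma transport_weightsD:
  assumes "transport_weights f"
  shows "f j \<in> borel_measurable borel" "0 \<le> f j x" "f j x \<le> 1" "(\<Sum>j\<in>UNIV. f j x) = 1"
proof -
  show 1: "f j \<in> borel_measurable borel" "0 \<le> f j x" "(\<Sum>j\<in>UNIV. f j x) = 1" for j x
    using assms by (auto simp: transport_weights_def)
  show "f j x \<le> 1"
    using member_le_sum[of j UNIV "\<lambda>j. f j x"] 1 by simp
qed

lemma sets_weighted_plan [simp, measurable_cong]: "sets (weighted_plan \<mu> y f) = sets borel"
  by (simp add: weighted_plan_def)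

lemma nn_integral_weighted_plan:
  fixes y :: "'m::finite \<Rightarrow> 'a::second_countable_topology"
  assumes \<mu> [measurable_cong]: "sets \<mu> = sets borel"
    and f: "\<And>j. f j \<in> borel_measurable borel"
    and \<phi> [measurable]: "\<phi> \<in> borel_measurable borel"
  shows "(\<integral>\<^sup>+p. \<phi> p \<partial>weighted_plan \<mu> y f) = (\<Sum>j\<in>UNIV. \<integral>\<^sup>+x. ennreal (f j x) * \<phi> (x, y j) \<partial>\<mu>)"
proof -
  interpret C: sigma_finite_measure "count_space (UNIV :: 'm set)"
    by (rule sigma_finite_measure_count_space_finite) simp
  have [measurable]: "(\<lambda>x. f j x) \<in> borel_measurable \<mu>" for j
    using f by simp
  have [measurable]: "(\<lambda>x. (x, y j)) \<in> \<mu> \<rightarrow>\<^sub>M borel" for j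
    unfolding borel_prod[symmetric] by measurable
  have [measurable]: "(\<lambda>(x, j). ennreal (f j x)) \<in> borel_measurable (\<mu> \<Otimes>\<^sub>M count_space UNIV)"
    unfolding case_prod_beta
    by (rule measurable_compose_countable'[where f="\<lambda>j p. ennreal (f j (fst p))" and g=snd and I=UNIV]) auto
  have [measurable]: "(\<lambda>(x, j). (x, y j)) \<in> \<mu> \<Otimes>\<^sub>M count_space UNIV \<rightarrow>\<^sub>M borel"
    unfolding borel_prod[symmetric] by measurable
  have "(\<integral>\<^sup>+p. \<phi> p \<partial>weighted_plan \<mu> y f)
    = (\<integral>\<^sup>+p. (case p of (x, j) \<Rightarrow> ennreal (f j x)) * \<phi> (case p of (x, j) \<Rightarrow> (x, y j))
        \<partial>(\<mu> \<Otimes>\<^sub>M count_space UNIV))"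
    unfolding weighted_plan_def by (simp add: nn_integral_distr nn_integral_density)
  also have "\<dots> = (\<integral>\<^sup>+x. \<integral>\<^sup>+j. ennreal (f j x) * \<phi> (x, y j) \<partial>count_space UNIV \<partial>\<mu>)"
    by (subst C.nn_integral_fst[symmetric]) (auto)
  also have "\<dots> = (\<integral>\<^sup>+x. (\<Sum>j\<in>UNIV. ennreal (f j x) * \<phi> (x, y j)) \<partial>\<mu>)"
    by (simp add: nn_integral_count_space_finite)
  also have "\<dots> = (\<Sum>j\<in>UNIV. \<integral>\<^sup>+x. ennreal (f j x) * \<phi> (x, y j) \<partial>\<mu>)"
    by (rule nn_integral_sum) measurable
  finally show ?thesis .
qed

lemma emeasure_weighted_plan:
  fixes y :: "'m::finite \<Rightarrow> 'a::second_countable_topology"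
  assumes "sets \<mu> = sets borel" "\<And>j. f j \<in> borel_measurable borel" "A \<in> sets borel"
  shows "emeasure (weighted_plan \<mu> y f) A
    = (\<Sum>j\<in>UNIV. \<integral>\<^sup>+x. ennreal (f j x) * indicator A (x, y j) \<partial>\<mu>)"
  using nn_integral_weighted_plan[OF assms(1,2), of "indicator A"] assms(3) by simp

lemma weighted_plan_cong_AE:
  fixes y :: "'m::finite \<Rightarrow> 'a::second_countable_topology"
  assumes "sets \<mu> = sets borel" "\<And>j. f j \<in> borel_measurable borel" "\<And>j. g j \<in> borel_measurable borel"
    and eq: "\<And>j. AE x in \<mu>. f j x = g j x"
  shows "weighted_plan \<mu> y f = weighted_plan \<mu> y g"
proof (rule measure_eqI)
  fix A assume "A \<in> sets (weighted_plan \<mu> y f)"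
  then have A: "A \<in> sets borel" by simp
  have "(\<integral>\<^sup>+x. ennreal (f j x) * indicator A (x, y j) \<partial>\<mu>) = (\<integral>\<^sup>+x. ennreal (g j x) * indicator A (x, y j) \<partial>\<mu>)" for j
    using eq[of j] by (intro nn_integral_cong_AE) auto
  then show "emeasure (weighted_plan \<mu> y f) A = emeasure (weighted_plan \<mu> y g) A"
    by (simp add: emeasure_weighted_plan assms A)
qed simp

lemma transport_weights_integrable:
  assumes "finite_measure \<mu>" "sets \<mu> = sets borel" "transport_weights f"
  shows "integrable \<mu> (f j)"
proof -
  interpret finite_measure \<mu> by fact
  show ?thesis
    using transport_weightsD[OF assms(3)] assms(2)
    by (intro integrable_const_bound[where B=1]) auto
qed

lemma integral_weighted_plan:
  fixes y :: "'m::finite \<Rightarrow> 'a::second_countable_topology"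
  assumes "finite_measure \<mu>" "sets \<mu> = sets borel" "transport_weights f"
    and \<phi>: "\<phi> \<in> borel_measurable borel" "\<And>p. 0 \<le> \<phi> p" "\<And>p. \<phi> p \<le> B"
  shows "(\<integral>p. \<phi> p \<partial>weighted_plan \<mu> y f) = (\<Sum>j\<in>UNIV. \<integral>x. f j x * \<phi> (x, y j) \<partial>\<mu>)"
proof -
  interpret finite_measure \<mu> by fact
  note f = transport_weightsD[OF assms(3)]
  have [measurable]: "(\<lambda>x. (x, y j)) \<in> \<mu> \<rightarrow>\<^sub>M borel" for j
    unfolding borel_prod[symmetric] using assms(2) by (auto simp: measurable_ident_sets)
  have [measurable]: "f j \<in> borel_measurable \<mu>" for j
    using f(1) assms(2) by simp
  note [measurable] = \<phi>(1)
  have int: "integrable \<mu> (\<lambda>x. f j x * \<phi> (x, y j))" for j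
    using f(2,3) \<phi>(2,3) by (intro integrable_mult_bounded[where a=1 and b=B]) auto
  have nn: "0 \<le> (\<integral>x. f j x * \<phi> (x, y j) \<partial>\<mu>)" for j
    using f(2) \<phi>(2) by (intro integral_nonneg_AE) simp
  have "(\<integral>p. \<phi> p \<partial>weighted_plan \<mu> y f) = enn2real (\<integral>\<^sup>+p. \<phi> p \<partial>weighted_plan \<mu> y f)"
    using \<phi> by (intro integral_eq_nn_integral) auto
  also have "(\<integral>\<^sup>+p. \<phi> p \<partial>weighted_plan \<mu> y f) = (\<Sum>j\<in>UNIV. \<integral>\<^sup>+x. ennreal (f j x * \<phi> (x, y j)) \<partial>\<mu>)"
    using \<phi> f by (subst nn_integral_weighted_plan) (auto simp: assms ennreal_mult)
  also have "\<dots> = (\<Sum>j\<in>UNIV. ennreal (\<integral>x. f j x * \<phi> (x, y j) \<partial>\<mu>))"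
    using int f(2) \<phi>(2) by (intro sum.cong refl nn_integral_eq_integral) auto
  also have "\<dots> = ennreal (\<Sum>j\<in>UNIV. \<integral>x. f j x * \<phi> (x, y j) \<partial>\<mu>)"
    using nn by (intro sum_ennreal) auto
  finally show ?thesis
    using nn by (simp add: sum_nonneg)
qed

lemma weighted_plan_in_transport_plans:
  fixes y :: "'m::finite \<Rightarrow> 'a::{second_countable_topology, t1_space}"
  assumes \<mu>: "borel_prob_on X \<mu>" and X: "X \<in> sets borel" and f: "transport_weights f"
  shows "weighted_plan \<mu> y f
    \<in> transport_plans X (range y) \<mu> (discrete_measure y (target_weights \<mu> f))"
proof -
  have sets: "sets \<mu> = sets borel" and \<mu>X: "emeasure \<mu> X = 1" and prob: "prob_space \<mu>"
    using \<mu> by (auto simp: borel_prob_on_def)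
  interpret prob_space \<mu> by fact
  note fD = transport_weightsD[OF f]
  have fm [measurable]: "f j \<in> borel_measurable \<mu>" for j using fD(1) sets by simp
  have left: "(\<Sum>j\<in>UNIV. \<integral>\<^sup>+x. ennreal (f j x) * indicator A x \<partial>\<mu>) = emeasure \<mu> A"
    if "A \<in> sets borel" for A
  proof -
    have [measurable]: "A \<in> sets \<mu>" using that sets by simp
    have "(\<Sum>j\<in>UNIV. \<integral>\<^sup>+x. ennreal (f j x) * indicator A x \<partial>\<mu>)
      = (\<integral>\<^sup>+x. (\<Sum>j\<in>UNIV. ennreal (f j x) * indicator A x) \<partial>\<mu>)"
      by (rule nn_integral_sum[symmetric]) measurable
    also have "\<dots> = (\<integral>\<^sup>+x. indicator A x \<partial>\<mu>)"
      using fD(2,4) by (simp add: sum_distrib_right[symmetric] sum_ennreal)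
    finally show ?thesis by simp
  qed
  have plan_eq: "emeasure (weighted_plan \<mu> y f) A
      = (\<Sum>j\<in>UNIV. \<integral>\<^sup>+x. ennreal (f j x) * indicator A (x, y j) \<partial>\<mu>)" if "A \<in> sets borel" for A
    using that by (intro emeasure_weighted_plan sets fD)
  have [measurable]: "fst \<in> weighted_plan \<mu> y f \<rightarrow>\<^sub>M borel" "snd \<in> weighted_plan \<mu> y f \<rightarrow>\<^sub>M borel"
    by (auto intro!: borel_measurable_continuous_onI continuous_intros simp: measurable_cong_sets[OF sets_weighted_plan refl])
  have space: "space (weighted_plan \<mu> y f) = UNIV"
    using sets_eq_imp_space_eq[OF sets_weighted_plan] by simp
  have fst_marg: "distr (weighted_plan \<mu> y f) borel fst = \<mu>"
  proof (rule measure_eqI)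
    fix A assume "A \<in> sets (distr (weighted_plan \<mu> y f) borel fst)"
    then have A: "A \<in> sets borel" by simp
    have "A \<times> UNIV \<in> sets (borel :: ('a \<times> 'a) measure)"
      using A by (intro borel_Times) auto
    then show "emeasure (distr (weighted_plan \<mu> y f) borel fst) A = emeasure \<mu> A"
      using A left[OF A] by (simp add: emeasure_distr space fst_vimage_eq_Times plan_eq indicator_times)
  qed (simp add: sets)
  have snd_marg: "distr (weighted_plan \<mu> y f) borel snd = discrete_measure y (\<chi> j. \<integral>x. f j x \<partial>\<mu>)"
  proof (rule measure_eqI)
    fix A assume "A \<in> sets (distr (weighted_plan \<mu> y f) borel snd)"
    then have A: "A \<in> sets borel" by simp
    have UA: "UNIV \<times> A \<in> sets (borel :: ('a \<times> 'a) measure)"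
      using A by (intro borel_Times) auto
    have "(\<integral>\<^sup>+x. ennreal (f j x) * indicator A (y j) \<partial>\<mu>)
        = ennreal (\<integral>x. f j x \<partial>\<mu>) * emeasure (return borel (y j)) A" for j
      using A fD(2) nn_integral_eq_integral[OF transport_weights_integrable[OF finite_measure_axioms sets f], of j]
      by (simp add: nn_integral_multc)
    then show "emeasure (distr (weighted_plan \<mu> y f) borel snd) A
      = emeasure (discrete_measure y (\<chi> j. \<integral>x. f j x \<partial>\<mu>)) A"
      using A UA by (simp add: emeasure_distr space snd_vimage_eq_Times plan_eq indicator_times
        emeasure_discrete_measure)
  qed simp
  have "range y \<in> sets borel"
    by (simp add: borel_closed finite_imp_closed)
  then have "X \<times> range y \<in> sets borel"
    using X by (rule borel_Times[rotated])
  then have "emeasure (weighted_plan \<mu> y f) (X \<times> range y) = 1"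
    using left[OF X] by (simp add: plan_eq indicator_times \<mu>X)
  moreover have "prob_space (weighted_plan \<mu> y f)"
    using prob_space.prob_space_distr[OF prob] 
    by (metis fst_marg prob \<open>fst \<in> weighted_plan \<mu> y f \<rightarrow>\<^sub>M borel\<close> prob_space_distrD)
  ultimately show ?thesis
    using fst_marg snd_marg by (simp add: transport_plans_def borel_prob_on_def target_weights_def)
qed

lemma target_weights_in_prob_simplex:
  assumes "prob_space \<mu>" "sets \<mu> = sets borel" "transport_weights f"
  shows "target_weights \<mu> f \<in> prob_simplex"
proof -
  interpret prob_space \<mu> by fact
  have "(\<Sum>j\<in>UNIV. \<integral>x. f j x \<partial>\<mu>) = (\<integral>x. (\<Sum>j\<in>UNIV. f j x) \<partial>\<mu>)"
    by (rule Bochner_Integration.integral_sum[symmetric])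
      (rule transport_weights_integrable[OF finite_measure_axioms assms(2,3)])
  then show ?thesis
    using transport_weightsD[OF assms(3)] by (simp add: target_weights_def prob_simplex_def prob_space)
qed

text \<open>
  Disintegration of a plan with finitely many targets. The part of \<open>\<gamma>\<close> over \<open>y j\<close>, projected to
  the first factor, is dominated by the first marginal \<open>\<mu>\<close> and therefore has a Radon--Nikodym
  density; these densities add up to 1 almost everywhere because the parts add up to \<open>\<gamma>\<close>.
\<close>
lemma transport_plan_eq_weighted_plan:
  fixes y :: "'m::finite \<Rightarrow> 'a::{second_countable_topology, t1_space}"
  assumes \<mu>: "borel_prob_on X \<mu>" and "inj y" and X: "X \<in> sets borel" and l: "l \<in> prob_simplex"
    and \<gamma>: "\<gamma> \<in> transport_plans X (range y) \<mu> (discrete_measure y l)"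
  obtains f where "transport_weights f" "\<gamma> = weighted_plan \<mu> y f" "l = target_weights \<mu> f"
proof -
  have sets: "sets \<mu> = sets borel" and prob: "prob_space \<mu>"
    using \<mu> by (auto simp: borel_prob_on_def)
  interpret prob_space \<mu> by fact
  have \<gamma>_sets [measurable_cong]: "sets \<gamma> = sets borel" and \<gamma>_prob: "prob_space \<gamma>"
    and \<gamma>_full: "emeasure \<gamma> (X \<times> range y) = 1"
    and fst_marg: "distr \<gamma> borel fst = \<mu>" and snd_marg: "distr \<gamma> borel snd = discrete_measure y l"
    using \<gamma> by (auto simp: transport_plans_def borel_prob_on_def)
  interpret \<Gamma>: prob_space \<gamma> by fact
  have \<gamma>_space: "space \<gamma> = UNIV"
    using sets_eq_imp_space_eq[OF \<gamma>_sets] by simp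
  have [measurable]: "fst \<in> \<gamma> \<rightarrow>\<^sub>M borel" "snd \<in> \<gamma> \<rightarrow>\<^sub>M borel"
    by (auto intro!: borel_measurable_continuous_onI continuous_intros simp: measurable_cong_sets[OF \<gamma>_sets refl])
  have slice_sets: "A \<times> {y j} \<in> sets \<gamma>" if "A \<in> sets borel" for A j
    using that by (simp add: \<gamma>_sets borel_Times)
  have strip_sets: "A \<times> UNIV \<in> sets \<gamma>" if "A \<in> sets borel" for A
    using that by (simp add: \<gamma>_sets borel_Times)
  have strip: "emeasure \<gamma> (A \<times> UNIV) = emeasure \<mu> A" if "A \<in> sets borel" for A
    using emeasure_distr[of fst \<gamma> borel A] that
    by (simp add: fst_marg \<gamma>_space fst_vimage_eq_Times)
  have range_sets: "range y \<in> sets borel"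
    by (simp add: borel_closed finite_imp_closed)
  have AE_range: "AE p in \<gamma>. snd p \<in> range y"
  proof -
    have "X \<times> range y \<in> sets \<gamma>" 
      using X range_sets by (simp add: \<gamma>_sets borel_Times)
    then have "AE p in \<gamma>. p \<in> X \<times> range y"
      using \<gamma>_full by (intro \<Gamma>.AE_prob_1) (simp add: measure_def)
    then show ?thesis by eventually_elim auto
  qed
  have split: "emeasure \<gamma> A = (\<Sum>j\<in>UNIV. emeasure \<gamma> (A \<inter> UNIV \<times> {y j}))" if A: "A \<in> sets \<gamma>" for A
  proof -
    have UN: "(\<Union>j. A \<inter> UNIV \<times> {y j}) = A \<inter> UNIV \<times> range y" by auto
    have m: "A \<inter> UNIV \<times> {y j} \<in> sets \<gamma>" for j
      using A slice_sets[of UNIV j] by auto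
    have "emeasure \<gamma> A = emeasure \<gamma> (A \<inter> UNIV \<times> range y)"
    proof (rule emeasure_eq_AE)
      show "A \<inter> UNIV \<times> range y \<in> sets \<gamma>"
        unfolding UN[symmetric] using m by (intro sets.finite_UN) auto
    qed (use AE_range A in auto)
    also have "\<dots> = (\<Sum>j\<in>UNIV. emeasure \<gamma> (A \<inter> UNIV \<times> {y j}))"
      unfolding UN[symmetric] using m \<open>inj y\<close>
      by (intro sum_emeasure[symmetric]) (auto simp: disjoint_family_on_def inj_def)
    finally show ?thesis .
  qed
  define \<mu>s where "\<mu>s j = distr (density \<gamma> (indicator (UNIV \<times> {y j}))) borel fst" for j
  have \<mu>s_sets: "sets (\<mu>s j) = sets \<mu>" for j by (simp add: \<mu>s_def sets)
  have slice: "emeasure (\<mu>s j) A = emeasure \<gamma> (A \<times> {y j})" if "A \<in> sets borel" for A j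
  proof -
    have "emeasure (\<mu>s j) A = emeasure \<gamma> (UNIV \<times> {y j} \<inter> A \<times> UNIV)"
      unfolding \<mu>s_def using that slice_sets[of UNIV j] strip_sets[OF that]
      by (simp add: emeasure_distr emeasure_density \<gamma>_space fst_vimage_eq_Times
        indicator_inter_arith[symmetric])
    then show ?thesis by (simp add: Times_Int_Times)
  qed
  have "\<exists>g \<in> borel_measurable \<mu>. density \<mu> g = \<mu>s j" for j
  proof (rule Radon_Nikodym[OF _ \<mu>s_sets])
    show "absolutely_continuous \<mu> (\<mu>s j)"
      unfolding absolutely_continuous_def
    proof
      fix A assume A: "A \<in> null_sets \<mu>"
      then have "A \<in> sets borel" using sets by auto
      then have "emeasure (\<mu>s j) A \<le> emeasure \<mu> A"
        using strip_sets[of A] by (subst slice, simp, subst strip[symmetric], simp, intro emeasure_mono) auto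
      with A show "A \<in> null_sets (\<mu>s j)" by (auto simp: null_sets_def \<mu>s_sets)
    qed
  qed
  then obtain g where g [measurable]: "\<And>j. g j \<in> borel_measurable \<mu>"
    and g_dens: "\<And>j. density \<mu> (g j) = \<mu>s j" by metis
  have g_sum: "AE x in \<mu>. (\<Sum>j\<in>UNIV. g j x) = 1"
  proof (rule density_unique)
    show "density \<mu> (\<lambda>x. \<Sum>j\<in>UNIV. g j x) = density \<mu> (\<lambda>x. 1)"
    proof (rule measure_eqI)
      fix A assume "A \<in> sets (density \<mu> (\<lambda>x. \<Sum>j\<in>UNIV. g j x))"
      then have A: "A \<in> sets borel" and A' [measurable]: "A \<in> sets \<mu>" by (auto simp: sets)
      have "emeasure (density \<mu> (\<lambda>x. \<Sum>j\<in>UNIV. g j x)) A = (\<Sum>j\<in>UNIV. emeasure (density \<mu> (g j)) A)"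
        by (simp add: emeasure_density nn_integral_sum[symmetric] sum_distrib_right del: sum_mult_indicator)
      also have "\<dots> = (\<Sum>j\<in>UNIV. emeasure \<gamma> ((A \<times> UNIV) \<inter> UNIV \<times> {y j}))"
        by (simp add: g_dens slice[OF A] Times_Int_Times)
      also have "\<dots> = emeasure \<mu> A"
        using split[OF strip_sets[OF A]] strip[OF A] by simp
      finally show "emeasure (density \<mu> (\<lambda>x. \<Sum>j\<in>UNIV. g j x)) A = emeasure (density \<mu> (\<lambda>x. 1)) A"
        by (simp add: emeasure_density)
    qed simp
  qed measurable
  \<comment> \<open>On the null set where the densities do not sum to 1, any fixed probability vector will do.\<close>
  define f where "f j x = (if (\<Sum>k\<in>UNIV. g k x) = 1 then enn2real (g j x) else 1 / real CARD('m))" for j x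
  have g_fin: "g j x < \<infinity>" if "(\<Sum>k\<in>UNIV. g k x) = 1" for j x
    using member_le_sum[of j UNIV "\<lambda>k. g k x"] that by (auto simp: le_less_trans)
  have "transport_weights f"
    unfolding transport_weights_def
  proof (intro conjI allI)
    fix j x
    have "f j \<in> borel_measurable \<mu>"
      unfolding f_def by measurable
    then show "f j \<in> borel_measurable borel" using sets by (simp cong: measurable_cong_sets)
    show "0 \<le> f j x" by (simp add: f_def)
    have "(\<Sum>k\<in>UNIV. enn2real (g k x)) = 1" if "(\<Sum>k\<in>UNIV. g k x) = 1"
      using g_fin[OF that] that enn2real_sum[of UNIV "\<lambda>k. g k x"] by (simp add: less_top)
    then show "(\<Sum>j\<in>UNIV. f j x) = 1"
      by (cases "(\<Sum>k\<in>UNIV. g k x) = 1") (simp_all add: f_def)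
  qed
  note fD = transport_weightsD[OF this]
  have fg: "AE x in \<mu>. ennreal (f j x) = g j x" for j
    using g_sum by eventually_elim (use g_fin in \<open>auto simp: f_def\<close>)
  have \<gamma>_eq: "\<gamma> = weighted_plan \<mu> y f"
  proof (rule measure_eqI)
    fix A assume A: "A \<in> sets \<gamma>"
    have "emeasure \<gamma> (A \<inter> UNIV \<times> {y j}) = (\<integral>\<^sup>+x. ennreal (f j x) * indicator A (x, y j) \<partial>\<mu>)" for j
    proof -
      define B where "B = {x. (x, y j) \<in> A}"
      have "(\<lambda>x. (x, y j)) \<in> borel \<rightarrow>\<^sub>M borel"
        by (intro borel_measurable_continuous_onI continuous_intros)
      from measurable_sets[OF this, of A] A have B: "B \<in> sets borel"
        by (simp add: B_def \<gamma>_sets vimage_def)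
      then have B' [measurable]: "B \<in> sets \<mu>" by (simp add: sets)
      have "A \<inter> UNIV \<times> {y j} = B \<times> {y j}" by (auto simp: B_def)
      then have "emeasure \<gamma> (A \<inter> UNIV \<times> {y j}) = emeasure (density \<mu> (g j)) B"
        by (simp add: g_dens slice[OF B])
      also have "\<dots> = (\<integral>\<^sup>+x. g j x * indicator B x \<partial>\<mu>)" by (simp add: emeasure_density)
      also have "\<dots> = (\<integral>\<^sup>+x. ennreal (f j x) * indicator A (x, y j) \<partial>\<mu>)"
        using fg[of j] by (intro nn_integral_cong_AE) (auto simp: B_def indicator_def)
      finally show ?thesis .
    qed
    then show "emeasure \<gamma> A = emeasure (weighted_plan \<mu> y f) A"
      using A by (subst split[OF A], subst emeasure_weighted_plan) (auto simp: sets \<gamma>_sets fD)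
  qed (simp add: \<gamma>_sets)
  have "l $ j = (\<integral>x. f j x \<partial>\<mu>)" for j
  proof -
    have mass: "emeasure (discrete_measure y l') {y j} = ennreal (l' $ j)" for l'
    proof -
      have "emeasure (discrete_measure y l') {y j} = (\<Sum>k\<in>UNIV. if k = j then ennreal (l' $ k) else 0)"
        using \<open>inj y\<close> by (auto simp: emeasure_discrete_measure indicator_def inj_eq intro!: sum.cong)
      then show ?thesis by simp
    qed
    have "discrete_measure y l = discrete_measure y (\<chi> j. \<integral>x. f j x \<partial>\<mu>)"
      using weighted_plan_in_transport_plans[OF \<mu> X \<open>transport_weights f\<close>, of y] snd_marg
      by (simp add: transport_plans_def target_weights_def \<gamma>_eq)
    then have "ennreal (l $ j) = ennreal (\<integral>x. f j x \<partial>\<mu>)"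
      using mass[of l] mass[of "\<chi> j. \<integral>x. f j x \<partial>\<mu>"] by simp
    then show ?thesis
      using l fD(2) by (simp add: prob_simplex_def)
  qed
  then have "l = target_weights \<mu> f" by (simp add: target_weights_def vec_eq_iff)
  with \<open>transport_weights f\<close> \<gamma>_eq show thesis by (rule that)
qed

section \<open>Optimal weights\<close>

definition transport_cost ::
  "'a measure \<Rightarrow> ('m::finite \<Rightarrow> 'a \<Rightarrow> real) \<Rightarrow> ('m \<Rightarrow> 'a \<Rightarrow> real) \<Rightarrow> real" where
  "transport_cost \<mu> C f = (\<Sum>j\<in>UNIV. \<integral>x. f j x * C j x \<partial>\<mu>)"

text \<open>
  Suppose the weights of \<open>j\<close> and \<open>k\<close> overlap, \<open>m = min (h j) (h k)\<close>. Any function \<open>\<phi>\<close> with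
  \<open>\<bar>\<phi>\<bar> \<le> m\<close> and mean zero can be moved from \<open>h j\<close> to \<open>h k\<close> without changing the marginals, and
  the cost drops by \<open>\<integral> \<phi> (C j - C k)\<close>. With \<open>\<phi>\<close> proportional to \<open>m (C j - C k - a)\<close>, where
  \<open>a\<close> is the \<open>m\<close>-weighted mean of \<open>C j - C k\<close>, the drop is proportional to the variance
  \<open>\<integral> m (C j - C k - a)\<^sup>2\<close>, which optimality forces to vanish. As \<open>C j - C k\<close> almost never
  equals \<open>a\<close>, the overlap \<open>m\<close> is null.
\<close>
lemma optimal_weights_are_indicators:
  fixes C :: "'m::finite \<Rightarrow> 'a::topological_space \<Rightarrow> real"
  assumes "prob_space \<mu>" and sets: "sets \<mu> = sets borel"
    and C: "\<And>j. C j \<in> borel_measurable borel" "\<And>j x. \<bar>C j x\<bar> \<le> B"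
    and level: "\<And>j k a. j \<noteq> k \<Longrightarrow> AE x in \<mu>. C j x - C k x \<noteq> a"
    and h: "transport_weights h"
    and opt: "\<And>h'. transport_weights h' \<Longrightarrow> target_weights \<mu> h' = target_weights \<mu> h \<Longrightarrow>
      transport_cost \<mu> C h \<le> transport_cost \<mu> C h'"
  shows "AE x in \<mu>. \<forall>j. h j x = 0 \<or> h j x = 1"
proof -
  interpret prob_space \<mu> by fact
  note hD = transport_weightsD[OF h]
  have [measurable]: "C j \<in> borel_measurable \<mu>" "h j \<in> borel_measurable \<mu>"
    "C j \<in> borel_measurable borel" "h j \<in> borel_measurable borel" for j
    using C(1) hD(1) sets by auto
  have hC_int: "integrable \<mu> (\<lambda>x. h i x * C i x)" for i
    using hD(2,3) C(2) by (intro integrable_mult_bounded[where a=1 and b=B]) auto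
  have overlap_null: "AE x in \<mu>. min (h j x) (h k x) = 0" if "j \<noteq> k" for j k
  proof -
    define m where "m x = min (h j x) (h k x)" for x
    have m: "0 \<le> m x" "m x \<le> h j x" "m x \<le> h k x" "m x \<le> 1" for x
      using hD(2,3) by (auto simp: m_def min_le_iff_disj)
    have [measurable]: "m \<in> borel_measurable \<mu>" "m \<in> borel_measurable borel" 
      unfolding m_def by measurable
    have m_int: "integrable \<mu> m"
      using m by (intro integrable_const_bound[where B=1]) auto
    define a where "a = (\<integral>x. m x * (C j x - C k x) \<partial>\<mu>) / (\<integral>x. m x \<partial>\<mu>)"
    define d where "d x = C j x - C k x - a" for x
    \<comment> \<open>\<open>K\<close> bounds \<open>\<bar>d\<bar>\<close>, which makes \<open>\<bar>\<phi>\<bar> \<le> m\<close> below; the summand 1 keeps it positive.\<close>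
    define K where "K = 2 * B + \<bar>a\<bar> + 1"
    have "0 \<le> B" using C(2)[of undefined undefined] by linarith
    then have "0 < K" by (simp add: K_def)
    have dK: "\<bar>d x\<bar> \<le> K" for x
      using C(2)[of j x] C(2)[of k x] by (auto simp: d_def K_def)
    have [measurable]: "d \<in> borel_measurable \<mu>" "d \<in> borel_measurable borel" 
      unfolding d_def by measurable
    define \<phi> where "\<phi> x = m x * d x / K" for x
    have [measurable]: "\<phi> \<in> borel_measurable \<mu>" "\<phi> \<in> borel_measurable borel"
      unfolding \<phi>_def by measurable
    have \<phi>m: "\<bar>\<phi> x\<bar> \<le> m x" for x
    proof -
      have "\<bar>\<phi> x\<bar> = m x * (\<bar>d x\<bar> / K)"
        using m(1)[of x] \<open>0 < K\<close> by (simp add: \<phi>_def abs_mult)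
      also have "\<dots> \<le> m x * 1"
        using m(1)[of x] \<open>0 < K\<close> dK[of x] by (intro mult_left_mono) auto
      finally show ?thesis by simp
    qed
    have \<phi>_int: "integrable \<mu> \<phi>"
      using \<phi>m m(4) by (intro integrable_const_bound[where B=1]) (auto intro: order_trans)
    have \<phi>_mult_int: "integrable \<mu> (\<lambda>x. \<phi> x * u x)"
      if "u \<in> borel_measurable \<mu>" and "\<And>x. \<bar>u x\<bar> \<le> b" for u b
      using that \<phi>m m(4) by (intro integrable_mult_bounded[where a=1 and b=b]) (auto intro: order_trans)
    show "AE x in \<mu>. min (h j x) (h k x) = 0"
    proof (cases "(\<integral>x. m x \<partial>\<mu>) = 0")
      case True
      then have "AE x in \<mu>. m x = 0"
        using m by (subst (asm) integral_nonneg_eq_0_iff_AE[OF m_int]) auto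
      then show ?thesis by (simp add: m_def)
    next
      case False
      have "integrable \<mu> (\<lambda>x. m x * (C j x - C k x))"
      proof (rule integrable_mult_bounded[where a=1 and b="2 * B"])
        show "\<bar>C j x - C k x\<bar> \<le> 2 * B" for x
          using C(2)[of j x] C(2)[of k x] by linarith
      qed (use m in auto)
      moreover have "\<phi> x = (m x * (C j x - C k x) - a * m x) / K" for x
        by (simp add: \<phi>_def d_def algebra_simps)
      ultimately have \<phi>_zero: "(\<integral>x. \<phi> x \<partial>\<mu>) = 0"
        using False m_int by (simp add: a_def)
      define h' where "h' i x = h i x + (if i = k then \<phi> x else 0) - (if i = j then \<phi> x else 0)" for i x
      have "transport_weights h'"
        unfolding transport_weights_def
      proof (intro conjI allI)
        fix i x
        show "h' i \<in> borel_measurable borel" unfolding h'_def by measurable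
        show "0 \<le> h' i x"
          using \<open>j \<noteq> k\<close> \<phi>m[of x] m[of x] hD(2)[of i x] by (auto simp: h'_def)
        show "(\<Sum>i\<in>UNIV. h' i x) = 1"
          using hD(4)[of x] by (simp add: h'_def sum.distrib sum_subtractf)
      qed
      moreover have "target_weights \<mu> h' = target_weights \<mu> h"
        unfolding target_weights_def vec_eq_iff
      proof
        fix i
        show "(\<chi> i. \<integral>x. h' i x \<partial>\<mu>) $ i = (\<chi> i. \<integral>x. h i x \<partial>\<mu>) $ i"
          using \<phi>_int \<phi>_zero transport_weights_integrable[OF finite_measure_axioms sets h, of i]
          by (cases "i = j"; cases "i = k") (simp_all add: h'_def)
      qed
      ultimately have "transport_cost \<mu> C h \<le> transport_cost \<mu> C h'" by (rule opt)
      also have "transport_cost \<mu> C h' = (\<Sum>i\<in>UNIV. (\<integral>x. h i x * C i x \<partial>\<mu>)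
          + (if i = k then \<integral>x. \<phi> x * C k x \<partial>\<mu> else 0) - (if i = j then \<integral>x. \<phi> x * C j x \<partial>\<mu> else 0))"
        unfolding transport_cost_def h'_def
        using hC_int \<phi>_mult_int[OF _ C(2)] \<open>j \<noteq> k\<close>
        by (intro sum.cong refl) (auto simp: algebra_simps)
      also have "\<dots> = transport_cost \<mu> C h + (\<integral>x. \<phi> x * C k x \<partial>\<mu>) - (\<integral>x. \<phi> x * C j x \<partial>\<mu>)"
        by (simp add: sum.distrib sum_subtractf transport_cost_def)
      finally have "(\<integral>x. \<phi> x * C j x \<partial>\<mu>) - (\<integral>x. \<phi> x * C k x \<partial>\<mu>) \<le> 0" by simp
      moreover have "(\<integral>x. \<phi> x * d x \<partial>\<mu>) = (\<integral>x. \<phi> x * C j x \<partial>\<mu>) - (\<integral>x. \<phi> x * C k x \<partial>\<mu>)"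
      proof -
        have "\<phi> x * d x = \<phi> x * C j x - \<phi> x * C k x - a * \<phi> x" for x
          by (simp add: d_def algebra_simps)
        then show ?thesis
          using \<phi>_int \<phi>_zero \<phi>_mult_int[OF _ C(2)] by simp
      qed
      moreover have pos: "0 \<le> \<phi> x * d x" for x
      proof -
        have "\<phi> x * d x = m x * (d x)\<^sup>2 / K" by (simp add: \<phi>_def power2_eq_square)
        then show ?thesis using m(1)[of x] \<open>0 < K\<close> by simp
      qed
      moreover have "0 \<le> (\<integral>x. \<phi> x * d x \<partial>\<mu>)" using pos by simp
      ultimately have "(\<integral>x. \<phi> x * d x \<partial>\<mu>) = 0" by linarith
      then have "AE x in \<mu>. \<phi> x * d x = 0"
        using pos \<phi>_mult_int[OF _ dK] by (subst (asm) integral_nonneg_eq_0_iff_AE) auto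
      moreover have "AE x in \<mu>. d x \<noteq> 0"
        using level[OF \<open>j \<noteq> k\<close>, of a] by (simp add: d_def)
      ultimately show ?thesis
        by eventually_elim (use \<open>0 < K\<close> in \<open>auto simp: \<phi>_def m_def\<close>)
    qed
  qed
  then have "AE x in \<mu>. \<forall>j k. j \<noteq> k \<longrightarrow> min (h j x) (h k x) = 0"
    by (simp add: AE_all_countable)
  then show ?thesis
  proof eventually_elim
    case (elim x)
    show ?case
    proof
      fix j
      show "h j x = 0 \<or> h j x = 1"
      proof (rule disjCI)
        assume "h j x \<noteq> 1"
        show "h j x = 0"
        proof (rule ccontr)
          assume "h j x \<noteq> 0"
          have "h k x = 0" if "k \<noteq> j" for k
            using elim[rule_format, of j k] that \<open>h j x \<noteq> 0\<close> hD(2)[of j x] hD(2)[of k x]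
            by (auto simp: min_def split: if_splits)
          then have "(\<Sum>k\<in>UNIV. h k x) = (\<Sum>k\<in>UNIV. if k = j then h j x else 0)"
            by (intro sum.cong) auto
          then show False using hD(4)[of x] \<open>h j x \<noteq> 1\<close> by simp
        qed
      qed
    qed
  qed
qed

text \<open>
  The midpoint \<open>h\<close> of two minimizers is again a minimizer, since the cost is linear and \<open>F\<close> is
  convex. So \<open>h\<close> is also cheapest among the weights with the same target measure, hence takes only
  the values 0 and 1; these are extreme points of \<open>[0, 1]\<close>, so both minimizers agree with \<open>h\<close>.
  The minimum has to be finite: otherwise any weights at all would be minimizers.
\<close>
lemma minimizing_weights_unique:
  fixes C :: "'m::finite \<Rightarrow> 'a::topological_space \<Rightarrow> real" and F :: "real ^ 'm \<Rightarrow> ereal"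
  defines "J \<equiv> \<lambda>\<mu> f. ereal (transport_cost \<mu> C f) + F (target_weights \<mu> f)"
  assumes "prob_space \<mu>" and sets: "sets \<mu> = sets borel"
    and C: "\<And>j. C j \<in> borel_measurable borel" "\<And>j x. \<bar>C j x\<bar> \<le> B"
    and level: "\<And>j k a. j \<noteq> k \<Longrightarrow> AE x in \<mu>. C j x - C k x \<noteq> a"
    and F: "\<And>l. F l \<noteq> -\<infinity>" "convex_fun F"
    and f: "transport_weights f" "\<And>h. transport_weights h \<Longrightarrow> J \<mu> f \<le> J \<mu> h"
    and g: "transport_weights g" "\<And>h. transport_weights h \<Longrightarrow> J \<mu> g \<le> J \<mu> h"
    and fin: "J \<mu> f < \<infinity>"
  shows "AE x in \<mu>. f j x = g j x"
proof -
  interpret prob_space \<mu> by fact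
  define h where "h j x = (f j x + g j x) / 2" for j x
  note fD = transport_weightsD[OF f(1)] and gD = transport_weightsD[OF g(1)]
  have h: "transport_weights h"
    unfolding transport_weights_def h_def
    using fD gD by (auto simp: sum.distrib sum_divide_distrib[symmetric])
  have int: "integrable \<mu> (\<lambda>x. u i x * C i x)" if "transport_weights u" for u i
    using transport_weightsD[OF that] C sets
    by (intro integrable_mult_bounded[where a=1 and b=B]) auto
  have T_h: "transport_cost \<mu> C h = (transport_cost \<mu> C f + transport_cost \<mu> C g) / 2"
  proof -
    have h_eq: "(\<integral>x. h i x * C i x \<partial>\<mu>) = ((\<integral>x. f i x * C i x \<partial>\<mu>) + (\<integral>x. g i x * C i x \<partial>\<mu>)) / 2" for i
      using int[OF f(1)] int[OF g(1)] by (simp add: h_def distrib_right)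
    show ?thesis
      unfolding transport_cost_def h_eq by (simp add: sum.distrib sum_divide_distrib[symmetric])
  qed
  have "target_weights \<mu> h = (1/2) *\<^sub>R target_weights \<mu> f + (1/2) *\<^sub>R target_weights \<mu> g"
    using transport_weights_integrable[OF finite_measure_axioms sets f(1)]
      transport_weights_integrable[OF finite_measure_axioms sets g(1)]
    by (simp add: target_weights_def h_def vec_eq_iff add_divide_distrib)
  then have F_h: "F (target_weights \<mu> h)
      \<le> ereal (1/2) * F (target_weights \<mu> f) + ereal (1/2) * F (target_weights \<mu> g)"
    using F(2) unfolding convex_fun_def by (metis add_divide_distrib divide_self_if half_gt_zero
      less_eq_real_def one_add_one zero_less_one zero_neq_numeral)
  have J_eq: "J \<mu> g = J \<mu> f" using f g by (intro antisym) auto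
  obtain a where a: "F (target_weights \<mu> f) = ereal a"
    using fin F(1) unfolding J_def by (cases "F (target_weights \<mu> f)") auto
  obtain b where b: "F (target_weights \<mu> g) = ereal b"
    using fin F(1) unfolding J_eq[symmetric] unfolding J_def by (cases "F (target_weights \<mu> g)") auto
  obtain e where e: "F (target_weights \<mu> h) = ereal e"
    using F_h F(1) by (cases "F (target_weights \<mu> h)") (auto simp: a b)
  have "AE x in \<mu>. \<forall>j. h j x = 0 \<or> h j x = 1"
  proof (rule optimal_weights_are_indicators[OF \<open>prob_space \<mu>\<close> sets C level h])
    fix h' :: "'m \<Rightarrow> 'a \<Rightarrow> real"
    assume h': "transport_weights h'" "target_weights \<mu> h' = target_weights \<mu> h"
    have "transport_cost \<mu> C f + a \<le> transport_cost \<mu> C h' + e"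
      using f(2)[OF h'(1)] by (simp add: J_def h'(2) a e)
    moreover have "transport_cost \<mu> C g + b = transport_cost \<mu> C f + a"
      using J_eq by (simp add: J_def a b)
    moreover have "e \<le> (a + b) / 2"
      using F_h by (simp add: a b e)
    ultimately show "transport_cost \<mu> C h \<le> transport_cost \<mu> C h'"
      unfolding T_h by argo
  qed
  then show ?thesis
  proof eventually_elim
    case (elim x)
    then have "f j x + g j x = 0 \<or> f j x + g j x = 2"
      by (auto simp: h_def)
    then show ?case
      by (elim disjE) (use fD(2,3)[of j x] gD(2,3)[of j x] in linarith)+
  qed
qed

section \<open>Uniqueness for the primal problem\<close>

theorem corollary4p5:
  fixes X :: "(real ^ 'n) set"
    and y :: "'m::finite \<Rightarrow> real ^ 'n"
    and \<mu> :: "(real ^ 'n) measure"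
    and c :: "real ^ 'n \<Rightarrow> real ^ 'n \<Rightarrow> real"
    and G :: "'m \<Rightarrow> real ^ 'n \<Rightarrow> real ^ 'n"
    and F :: "real ^ 'm \<Rightarrow> ereal"
  assumes "compact X"
    and "inj y"
    and "borel_prob_on X \<mu>" and "spt \<mu> = X"
    and "\<And>x j. x \<in> X \<Longrightarrow> c x (y j) \<ge> 0"
    and "continuous_on (X \<times> range y) (\<lambda>(x, z). c x z)"
    and "\<And>j. C1_on_with_gradient X (\<lambda>x. c x (y j)) (G j)"
    and "\<And>l. F l \<noteq> -\<infinity>"
    and "proper_fun F" and "closed_fun F" and "convex_fun F"
    and "dom_fun F \<subseteq> prob_simplex"
    and "absolutely_continuous lborel \<mu>"
    and "twist X G"
  shows "\<exists>\<^sub>\<le>\<^sub>1 p. is_arg_min (primal_cost X y c F) (primal_feasible X y \<mu>) p"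
proof -
  have sets: "sets \<mu> = sets borel" and prob: "prob_space \<mu>" and \<mu>X: "emeasure \<mu> X = 1"
    using \<open>borel_prob_on X \<mu>\<close> by (auto simp: borel_prob_on_def)
  interpret prob_space \<mu> by (rule prob)
  have X: "X \<in> sets borel" using \<open>compact X\<close> by (rule borel_compact)
  define XY where "XY = X \<times> range y"
  \<comment> \<open>Outside \<open>X \<times> range y\<close> nothing is known about \<open>c\<close>, so it is cut off there.\<close>
  define \<phi> where "\<phi> p = indicator XY p *\<^sub>R (case p of (x, z) \<Rightarrow> c x z)" for p
  define C where "C j x = \<phi> (x, y j)" for j x
  have "compact XY"
    unfolding XY_def by (intro compact_Times \<open>compact X\<close> finite_imp_compact) simp
  have \<phi>_meas: "\<phi> \<in> borel_measurable borel"
    unfolding \<phi>_def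
    using \<open>continuous_on (X \<times> range y) (\<lambda>(x, z). c x z)\<close> borel_compact[OF \<open>compact XY\<close>]
    by (intro borel_measurable_continuous_on_indicator) (auto simp: XY_def)
  have \<phi>_nonneg: "0 \<le> \<phi> p" for p
    using assms(5) by (auto simp: \<phi>_def XY_def indicator_def split: prod.splits)
  obtain B where B: "\<phi> p \<le> B" for p
  proof -
    have "compact ((\<lambda>(x, z). c x z) ` XY)"
      using \<open>continuous_on (X \<times> range y) (\<lambda>(x, z). c x z)\<close> \<open>compact XY\<close>
      unfolding XY_def by (rule compact_continuous_image)
    then obtain B where B: "\<And>p. p \<in> XY \<Longrightarrow> norm (case p of (x, z) \<Rightarrow> c x z) \<le> B"
      by (metis (no_types, lifting) bounded_iff compact_imp_bounded imageI)
    have "\<phi> p \<le> max B 0" for p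
      using B[of p] by (auto simp: \<phi>_def indicator_def)
    then show thesis by (rule that)
  qed
  have C_meas: "C j \<in> borel_measurable borel" for j
    unfolding C_def by (rule measurable_compose[OF _ \<phi>_meas])
      (intro borel_measurable_continuous_onI continuous_intros)
  have C_bound: "\<bar>C j x\<bar> \<le> B" for j x
    using B \<phi>_nonneg by (simp add: C_def)
  have C_eq: "C j x = c x (y j)" if "x \<in> X" for j x
    using that by (simp add: C_def \<phi>_def XY_def)
  \<comment> \<open>This is where the twist condition and absolute continuity enter: the gradient of
    \<open>C j - C k\<close> never vanishes on \<open>X\<close>.\<close>
  have level: "AE x in \<mu>. C j x - C k x \<noteq> a" if "j \<noteq> k" for j k a
  proof -
    define E where "E = {x\<in>X. c x (y j) - c x (y k) = a}"
    have C1: "C1_on_with_gradient X (\<lambda>x. c x (y j) - c x (y k)) (\<lambda>x. G j x - G k x)"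
      using assms(7)[of j] assms(7)[of k]
      by (auto simp: C1_on_with_gradient_def inner_diff_left intro!: continuous_intros has_derivative_diff)
    have "G j x - G k x \<noteq> 0" if "x \<in> X" for x
      using \<open>twist X G\<close> that \<open>j \<noteq> k\<close> by (auto simp: twist_def)
    then have "negligible E"
      unfolding E_def using \<open>compact X\<close> C1 by (intro negligible_level_set_of_nonzero_gradient) auto
    moreover have "E \<in> sets borel"
    proof -
      have "E = X \<inter> {x. C j x - C k x = a}" by (auto simp: E_def C_eq)
      moreover have "{x. C j x - C k x = a} \<in> sets borel"
        using C_meas[of j] C_meas[of k] by measurable
      ultimately show ?thesis using X by auto
    qed
    ultimately have "E \<in> null_sets lborel"
      by (simp add: negligible_iff_null_sets null_sets_completion_iff)
    then have "E \<in> null_sets \<mu>"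
      using \<open>absolutely_continuous lborel \<mu>\<close> by (auto simp: absolutely_continuous_def)
    moreover have "AE x in \<mu>. x \<in> X"
      using \<mu>X X sets by (intro AE_prob_1) (simp add: measure_def)
    ultimately show ?thesis
      using AE_not_in[of E \<mu>] by (auto simp: E_def C_eq elim: eventually_elim2)
  qed
  define J where "J f = ereal (transport_cost \<mu> C f) + F (target_weights \<mu> f)" for f
  have feasible: "primal_feasible X y \<mu> (weighted_plan \<mu> y f, target_weights \<mu> f)"
    if "transport_weights f" for f
    using that weighted_plan_in_transport_plans[OF assms(3) X that, of y]
      target_weights_in_prob_simplex[OF prob sets that]
    by (simp add: primal_feasible_def)
  have cost: "primal_cost X y c F (weighted_plan \<mu> y f, target_weights \<mu> f) = J f"
    if "transport_weights f" for f
    using integral_weighted_plan[OF finite_measure_axioms sets that \<phi>_meas \<phi>_nonneg B, of y]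
    by (simp add: primal_cost_def J_def transport_cost_def C_def set_lebesgue_integral_def \<phi>_def XY_def)
  have weights: "\<exists>f. transport_weights f \<and> p = (weighted_plan \<mu> y f, target_weights \<mu> f) \<and>
      (\<forall>h. transport_weights h \<longrightarrow> J f \<le> J h)"
    if p: "is_arg_min (primal_cost X y c F) (primal_feasible X y \<mu>) p" for p
  proof -
    obtain \<gamma> l where \<gamma>l: "p = (\<gamma>, l)" by fastforce
    then have "l \<in> prob_simplex" "\<gamma> \<in> transport_plans X (range y) \<mu> (discrete_measure y l)"
      using p by (auto simp: is_arg_min_def primal_feasible_def)
    from transport_plan_eq_weighted_plan[OF assms(3,2) X this]
    obtain f where f: "transport_weights f" and pf: "p = (weighted_plan \<mu> y f, target_weights \<mu> f)"
      unfolding \<gamma>l by metis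
    have "J f \<le> J h" if "transport_weights h" for h
    proof -
      have "primal_cost X y c F p \<le> primal_cost X y c F (weighted_plan \<mu> y h, target_weights \<mu> h)"
        using p feasible[OF that] unfolding is_arg_min_def by (meson not_less)
      then show ?thesis by (simp add: pf cost f that)
    qed
    with f pf show ?thesis by blast
  qed
  \<comment> \<open>Splitting every point in the proportions \<open>l\<close> gives a plan of finite cost.\<close>
  obtain h0 :: "'m \<Rightarrow> real ^ 'n \<Rightarrow> real" where h0: "transport_weights h0" "J h0 < \<infinity>"
  proof -
    obtain l where "F l < \<infinity>"
      using \<open>proper_fun F\<close> by (auto simp: proper_fun_def)
    then have l: "l \<in> prob_simplex" using assms(12) by (auto simp: dom_fun_def)
    show thesis
    proof
      show "transport_weights (\<lambda>j x. l $ j)"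
        using l by (simp add: transport_weights_def prob_simplex_def)
      have "target_weights \<mu> (\<lambda>j x. l $ j) = l"
        by (simp add: target_weights_def vec_eq_iff prob_space)
      then show "J (\<lambda>j x. l $ j) < \<infinity>"
        using \<open>F l < \<infinity>\<close> by (simp add: J_def)
    qed
  qed
  show ?thesis
  proof (rule Uniq_I)
    fix p q
    assume "is_arg_min (primal_cost X y c F) (primal_feasible X y \<mu>) p"
      and "is_arg_min (primal_cost X y c F) (primal_feasible X y \<mu>) q"
    then obtain f g where f: "transport_weights f" "\<And>h. transport_weights h \<Longrightarrow> J f \<le> J h"
        and p: "p = (weighted_plan \<mu> y f, target_weights \<mu> f)"
      and g: "transport_weights g" "\<And>h. transport_weights h \<Longrightarrow> J g \<le> J h"
        and q: "q = (weighted_plan \<mu> y g, target_weights \<mu> g)"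
      using weights by meson
    have "J f < \<infinity>" using f(2)[OF h0(1)] h0(2) by (rule le_less_trans)
    then have eq: "AE x in \<mu>. f j x = g j x" for j
      using f g unfolding J_def
      by (intro minimizing_weights_unique[where C=C and F=F and B=B] prob sets C_meas C_bound level assms) auto
    have fm: "f j \<in> borel_measurable borel" and gm: "g j \<in> borel_measurable borel" for j
      using f(1) g(1) by (auto simp: transport_weights_def)
    have "target_weights \<mu> f = target_weights \<mu> g"
      unfolding target_weights_def vec_eq_iff
      using eq fm gm sets by (auto intro!: integral_cong_AE)
    moreover have "weighted_plan \<mu> y f = weighted_plan \<mu> y g"
      using sets fm gm eq by (rule weighted_plan_cong_AE)
    ultimately show "p = q" by (simp add: p q)
  qed
qed

end
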